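(* Let $[a,b]\subset\mathbb{R}$, $\mu$ be Lebesgue measure on $[a,b]$, $\omega$ a modulus of continuity, $Q=\{q_1,\dots,q_n\}$ a set of $n\in\mathbb{N}$ points of $[a,b]$, $e\in\mathbb{R}^n_+$, and let $k:[a,b]^2\to\mathbb{R}$ be a continuous kernel with resolvent kernel $\Gamma$. Let $A$ be the solution operator $f\mapsto x=Af$ of the Volterra equation $x(t)=f(t)+\int_a^tk(t,s)x(s)\,d\mu(s)$, $t\in[a,b]$, i.e. $$(Af)(t)=f(t)+\int_a^t\Gamma(t,s)f(s)\,d\mu(s),\qquad t\in[a,b].$$ Let $Y\subset\mathfrak{M}([a,b],\mu)$ be a normed lattice containing the set $B_\mu([a,b])$ of $\mu$-essentially bounded functions on $[a,b]$. If the kernel $k$ is non-negative on $[a,b]^2$, then the method $\Phi=A\,L_{\omega,Q,e}$ is an optimal method of recovery of the operator $A$ on the class $H^\omega_\mu([a,b])$ based on information $I_Q$ with $U_e$-error, and $$\mathcal{E}(A;H^\omega_\mu([a,b]);I_Q;U_e)=\mathcal{E}(A;H^\omega_\mu([a,b]);I_Q;U_e;\Phi)=\|A\tau_{\omega,Q,e}\|_Y=\left\|\tau_{\omega,Q,e}(\cdot)+\int_a^{(\cdot)}\Gamma((\cdot),s)\,\tau_{\omega,Q,e}(s)\,d\mu(s)\right\|_Y.$$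
   Context: Resolvent kernel: $\Gamma(t,s)=\sum_{n=1}^\infty k_n(t,s)$, $k_1=k$, $k_n(t,s)=\int_s^tk(t,\tau)k_{n-1}(\tau,s)\,d\mu(\tau)$ for $n\ge2$. The formula for $Af$ is used for all $f\in B_\mu([a,b])$. $\mathbb{R}_+=[0,\infty)$. A modulus of continuity is a continuous non-decreasing $\omega:\mathbb{R}_+\to\mathbb{R}_+$ with $\omega(0)=0$ and $\omega(t'+t'')\le\omega(t')+\omega(t'')$. $H^\omega_\mu([a,b])=\{x:[a,b]\to\mathbb{R}:|x(t')-x(t'')|\le\omega(|t'-t''|)\ \forall t',t''\}$. $I_Qx=(x(q_1),\dots,x(q_n))$; $U_e=[-e_1,e_1]\times\dots\times[-e_n,e_n]$; $\tau_{\omega,Q,e}(t)=\min_{1\le j\le n}(e_j+\omega(|t-q_j|))$. Put $\Pi'_j=\{t\in[a,b]:\tau_{\omega,Q,e}(t)=e_j+\omega(|t-q_j|)\}$, $\Pi_1=\Pi'_1$, $\Pi_j=\Pi'_j\setminus\bigcup_{s<j}\Pi_s$; $L_{\omega,Q,e}:\mathbb{R}^n\to B_\mu([a,b])$, $L_{\omega,Q,e}z(t)=z_j$ for $t\in\Pi_j$. $\mathfrak{M}([a,b],\mu)$ is the space of measurable a.e. finite functions modulo a.e. equality, ordered by $x'\prec x''$ iff $x'\le x''$ a.e. A normed lattice $Y\subset\mathfrak{M}([a,b],\mu)$ is a normed space which is a vector lattice for the inherited order with $|x|\prec|y|\Rightarrow\|x\|_Y\le\|y\|_Y$. A method of recovery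 is an arbitrary map $\Phi:\mathbb{R}^n\to Y$; $\mathcal{E}(A;W;I_Q;U_e;\Phi)=\sup_{x\in W}\sup_{z\in I_Qx+U_e}\|Ax-\Phi z\|_Y$; $\mathcal{E}(A;W;I_Q;U_e)=\inf_\Phi\mathcal{E}(A;W;I_Q;U_e;\Phi)$; a method is optimal if it attains this infimum. *)

theory Defs
  imports "HOL-Analysis.Analysis"
begin

section \<open>Normed lattices of measurable functions\<close>

text \<open>
  Elements of the space of measurable, almost everywhere finite functions modulo almost
  everywhere equality are handled through real-valued representatives: a subset of the space
  is a set \<open>Y\<close> of measurable functions closed under almost everywhere equality, and a norm
  is a function \<open>N\<close> of representatives that does not distinguish equal classes.
\<close>

text \<open>
  The supremum is taken in \<open>Y\<close> with the inherited order, so it is a least upper bound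
  among elements of \<open>Y\<close>; it is not assumed to be the pointwise maximum.
\<close>

definition is_ae_sup ::
  "'a measure \<Rightarrow> ('a \<Rightarrow> real) set \<Rightarrow> ('a \<Rightarrow> real) \<Rightarrow> ('a \<Rightarrow> real) \<Rightarrow> ('a \<Rightarrow> real) \<Rightarrow> bool"
  where
  "is_ae_sup M Y f g h \<longleftrightarrow>
     h \<in> Y \<and> (AE x in M. f x \<le> h x) \<and> (AE x in M. g x \<le> h x) \<and>
     (\<forall>u\<in>Y. (AE x in M. f x \<le> u x) \<longrightarrow> (AE x in M. g x \<le> u x) \<longrightarrow> (AE x in M. h x \<le> u x))"

locale normed_function_lattice =
  fixes M :: "'a measure" and Y :: "('a \<Rightarrow> real) set" and N :: "('a \<Rightarrow> real) \<Rightarrow> real"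
  assumes measurable: "Y \<subseteq> borel_measurable M"
    and ae_closed: "\<lbrakk>f \<in> Y; g \<in> borel_measurable M; AE x in M. f x = g x\<rbrakk> \<Longrightarrow> g \<in> Y"
    and norm_ae_cong: "\<lbrakk>f \<in> Y; g \<in> Y; AE x in M. f x = g x\<rbrakk> \<Longrightarrow> N f = N g"
    and zero_closed: "(\<lambda>x. 0) \<in> Y"
    and add_closed: "\<lbrakk>f \<in> Y; g \<in> Y\<rbrakk> \<Longrightarrow> (\<lambda>x. f x + g x) \<in> Y"
    and scale_closed: "f \<in> Y \<Longrightarrow> (\<lambda>x. c * f x) \<in> Y"
    and norm_eq_zero_iff: "f \<in> Y \<Longrightarrow> N f = 0 \<longleftrightarrow> (AE x in M. f x = 0)"
    and norm_scale: "f \<in> Y \<Longrightarrow> N (\<lambda>x. c * f x) = \<bar>c\<bar> * N f"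
    and norm_triangle: "\<lbrakk>f \<in> Y; g \<in> Y\<rbrakk> \<Longrightarrow> N (\<lambda>x. f x + g x) \<le> N f + N g"
    and sup_exists: "\<lbrakk>f \<in> Y; g \<in> Y\<rbrakk> \<Longrightarrow> \<exists>h. is_ae_sup M Y f g h"
    \<comment> \<open>Below \<open>u\<close> and \<open>v\<close> are the moduli of \<open>f\<close> and \<open>g\<close> in the vector lattice \<open>Y\<close>.\<close>
    and norm_mono: "\<lbrakk>f \<in> Y; g \<in> Y; is_ae_sup M Y f (\<lambda>x. - f x) u;
        is_ae_sup M Y g (\<lambda>x. - g x) v; AE x in M. u x \<le> v x\<rbrakk> \<Longrightarrow> N f \<le> N g"

definition ess_bounded :: "'a measure \<Rightarrow> ('a \<Rightarrow> real) set" where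
  "ess_bounded M = {f \<in> borel_measurable M. \<exists>C. AE x in M. \<bar>f x\<bar> \<le> C}"


section \<open>Optimal recovery\<close>

text \<open>
  Methods range over arbitrary maps into \<open>Y\<close>. Errors lie in the extended reals because
  the supremum may be infinite.
\<close>

definition recovery_methods :: "('a \<Rightarrow> real) set \<Rightarrow> ('i \<Rightarrow> 'a \<Rightarrow> real) set" where
  "recovery_methods Y = {\<Phi>. \<forall>z. \<Phi> z \<in> Y}"

definition recovery_error ::
  "(('a \<Rightarrow> real) \<Rightarrow> real) \<Rightarrow> ('x \<Rightarrow> 'a \<Rightarrow> real) \<Rightarrow> 'x set \<Rightarrow> ('x \<Rightarrow> 'i::plus) \<Rightarrow> 'i set
    \<Rightarrow> ('i \<Rightarrow> 'a \<Rightarrow> real) \<Rightarrow> ereal" where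
  "recovery_error N A W I U \<Phi> =
     (SUP x\<in>W. SUP z\<in>(\<lambda>u. I x + u) ` U. ereal (N (\<lambda>t. A x t - \<Phi> z t)))"

definition optimal_recovery_error ::
  "('a \<Rightarrow> real) set \<Rightarrow> (('a \<Rightarrow> real) \<Rightarrow> real) \<Rightarrow> ('x \<Rightarrow> 'a \<Rightarrow> real) \<Rightarrow> 'x set \<Rightarrow> ('x \<Rightarrow> 'i::plus)
    \<Rightarrow> 'i set \<Rightarrow> ereal" where
  "optimal_recovery_error Y N A W I U = (INF \<Phi>\<in>recovery_methods Y. recovery_error N A W I U \<Phi>)"

definition optimal_method ::
  "('a \<Rightarrow> real) set \<Rightarrow> (('a \<Rightarrow> real) \<Rightarrow> real) \<Rightarrow> ('x \<Rightarrow> 'a \<Rightarrow> real) \<Rightarrow> 'x set \<Rightarrow> ('x \<Rightarrow> 'i::plus)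
    \<Rightarrow> 'i set \<Rightarrow> ('i \<Rightarrow> 'a \<Rightarrow> real) \<Rightarrow> bool" where
  "optimal_method Y N A W I U \<Phi> \<longleftrightarrow>
     \<Phi> \<in> recovery_methods Y \<and>
     recovery_error N A W I U \<Phi> = optimal_recovery_error Y N A W I U"


section \<open>The class, the information and the step-function operator\<close>

text \<open>
  Functions on \<open>[a,b]\<close> are total functions whose values outside \<open>{a..b}\<close> are irrelevant.
\<close>

definition modulus_of_continuity :: "(real \<Rightarrow> real) \<Rightarrow> bool" where
  "modulus_of_continuity \<omega> \<longleftrightarrow>
     continuous_on {0..} \<omega> \<and> mono_on {0..} \<omega> \<and> (\<forall>t\<ge>0. \<omega> t \<ge> 0) \<and> \<omega> 0 = 0 \<and>
     (\<forall>t'\<ge>0. \<forall>t''\<ge>0. \<omega> (t' + t'') \<le> \<omega> t' + \<omega> t'')"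

definition H_class :: "(real \<Rightarrow> real) \<Rightarrow> real \<Rightarrow> real \<Rightarrow> (real \<Rightarrow> real) set" where
  "H_class \<omega> a b = {x. \<forall>t'\<in>{a..b}. \<forall>t''\<in>{a..b}. \<bar>x t' - x t''\<bar> \<le> \<omega> \<bar>t' - t''\<bar>}"

definition point_values :: "real ^ 'n \<Rightarrow> (real \<Rightarrow> real) \<Rightarrow> real ^ 'n" where
  "point_values q x = (\<chi> j. x (q $ j))"

definition tau :: "(real \<Rightarrow> real) \<Rightarrow> real ^ 'n \<Rightarrow> real ^ 'n \<Rightarrow> real \<Rightarrow> real" where
  "tau \<omega> q e t = (MIN j. e $ j + \<omega> \<bar>t - q $ j\<bar>)"

definition pre_cell ::
  "real \<Rightarrow> real \<Rightarrow> (real \<Rightarrow> real) \<Rightarrow> real ^ 'n \<Rightarrow> real ^ 'n \<Rightarrow> 'n \<Rightarrow> real set" where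
  "pre_cell a b \<omega> q e j = {t \<in> {a..b}. tau \<omega> q e t = e $ j + \<omega> \<bar>t - q $ j\<bar>}"

text \<open>
  The linear order on the index type plays the role of the numbering \<open>1,\<dots>,n\<close>; at its
  least element the union below is empty.
\<close>

function cell ::
  "real \<Rightarrow> real \<Rightarrow> (real \<Rightarrow> real) \<Rightarrow> real ^ 'n::{finite,linorder} \<Rightarrow> real ^ 'n::{finite,linorder}
    \<Rightarrow> 'n::{finite,linorder} \<Rightarrow> real set"
  where
  "cell a b \<omega> q e j = pre_cell a b \<omega> q e j - (\<Union>s\<in>{..<j}. cell a b \<omega> q e s)"
  by pat_completeness auto
termination
proof (relation "Wellfounded.measure (\<lambda>(a, b, \<omega>, q, e, j). card {..<j})")
  fix a b :: real and \<omega> :: "real \<Rightarrow> real" and q e :: "real ^ 'n::{finite,linorder}"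
    and j s :: "'n::{finite,linorder}"
  assume "s \<in> {..<j}"
  then have "{..<s} \<subset> {..<j}"
    by auto
  then have "card {..<s} < card {..<j}"
    by (intro psubset_card_mono) auto
  then show "((a, b, \<omega>, q, e, s), (a, b, \<omega>, q, e, j))
      \<in> Wellfounded.measure (\<lambda>(a, b, \<omega>, q, e, j). card {..<j})"
    by simp
qed simp

declare cell.simps [simp del]

definition step_fun ::
  "real \<Rightarrow> real \<Rightarrow> (real \<Rightarrow> real) \<Rightarrow> real ^ 'n::{finite,linorder} \<Rightarrow> real ^ 'n::{finite,linorder}
    \<Rightarrow> real ^ 'n::{finite,linorder} \<Rightarrow> real \<Rightarrow> real" where
  "step_fun a b \<omega> q e z t = z $ (THE j. t \<in> cell a b \<omega> q e j)"

lemma cell_disjoint: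
  assumes "t \<in> cell a b \<omega> q e i" "t \<in> cell a b \<omega> q e j"
  shows "i = j"
  using assms cell.simps[of a b \<omega> q e i] cell.simps[of a b \<omega> q e j]
  by (cases i j rule: linorder_cases) auto

lemma step_fun_eq: "t \<in> cell a b \<omega> q e j \<Longrightarrow> step_fun a b \<omega> q e z t = z $ j"
  unfolding step_fun_def using cell_disjoint by (metis the_equality)


section \<open>Volterra equations\<close>

text \<open>
  \<open>iterated_kernel k n\<close> is the iterated kernel with index \<open>n + 1\<close>. For \<open>t < s\<close>
  the integral over \<open>{s..t}\<close> vanishes; only the values for \<open>s \<le> t\<close> matter.
\<close>

primrec iterated_kernel :: "(real \<Rightarrow> real \<Rightarrow> real) \<Rightarrow> nat \<Rightarrow> real \<Rightarrow> real \<Rightarrow> real" where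
  "iterated_kernel k 0 = k"
| "iterated_kernel k (Suc n) =
     (\<lambda>t s. LINT r:{s..t}|lebesgue. k t r * iterated_kernel k n r s)"

definition resolvent_kernel :: "(real \<Rightarrow> real \<Rightarrow> real) \<Rightarrow> real \<Rightarrow> real \<Rightarrow> real" where
  "resolvent_kernel k t s = (\<Sum>n. iterated_kernel k n t s)"

text \<open>
  The operator sending \<open>f\<close> to the solution \<open>x\<close> of
  \<open>x t = f t + (LINT s:{a..t}|lebesgue. k t s * x s)\<close>, given by the resolvent.
\<close>

definition volterra_solution ::
  "real \<Rightarrow> (real \<Rightarrow> real \<Rightarrow> real) \<Rightarrow> (real \<Rightarrow> real) \<Rightarrow> real \<Rightarrow> real" where
  "volterra_solution a k f t = f t + (LINT s:{a..t}|lebesgue. resolvent_kernel k t s * f s)"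

end

theory Submission
  imports Defs
begin

text \<open>
  A non-negative kernel has a non-negative resolvent, so \<open>A\<close> is linear and monotone, and the
  pointwise bound \<open>\<bar>x - L z\<bar> \<le> \<tau>\<close> becomes \<open>\<bar>A x - A (L z)\<bar> \<le> A \<tau>\<close>; this bounds the
  error of \<open>\<Phi>\<close>. Conversely \<open>\<tau>\<close> and \<open>- \<tau>\<close> both lie in the class and are compatible
  with the information \<open>0\<close>, so a method cannot tell them apart, and by the triangle
  inequality it errs by at least the norm of \<open>A \<tau>\<close> on one of them.
\<close>

section \<open>Norm inequalities in the lattice, and essentially bounded functions\<close>

text \<open>If the pointwise absolute value belongs to \<open>Y\<close>, it is a least upper bound
  of \<open>h\<close> and \<open>- h\<close> in \<open>Y\<close>. This makes
  \<open>norm_mono\<close>, which speaks only of such suprema, usable for pointwise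
  estimates.\<close>

lemma (in normed_function_lattice) norm_le_of_abs_le:
  assumes "f \<in> Y" "g \<in> Y" "(\<lambda>x. \<bar>f x\<bar>) \<in> Y" "(\<lambda>x. \<bar>g x\<bar>) \<in> Y"
    and "AE x in M. \<bar>f x\<bar> \<le> \<bar>g x\<bar>"
  shows "N f \<le> N g"
proof -
  have abs: "is_ae_sup M Y h (\<lambda>x. - h x) (\<lambda>x. \<bar>h x\<bar>)" if "(\<lambda>x. \<bar>h x\<bar>) \<in> Y" for h
    unfolding is_ae_sup_def
  proof (intro conjI ballI impI)
    fix u assume "AE x in M. h x \<le> u x" "AE x in M. - h x \<le> u x"
    then show "AE x in M. \<bar>h x\<bar> \<le> u x" by eventually_elim simp
  qed (use that in auto)
  show ?thesis
    by (rule norm_mono[OF assms(1,2) abs[OF assms(3)] abs[OF assms(4)] assms(5)])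
qed

lemma abs_ess_bounded:
  assumes "f \<in> ess_bounded M"
  shows "(\<lambda>x. \<bar>f x\<bar>) \<in> ess_bounded M"
  using assms unfolding ess_bounded_def by auto

lemma ess_bounded_diff:
  assumes "f \<in> ess_bounded M" "g \<in> ess_bounded M"
  shows "(\<lambda>x. f x - g x) \<in> ess_bounded M"
proof -
  obtain C D where "AE x in M. \<bar>f x\<bar> \<le> C" "AE x in M. \<bar>g x\<bar> \<le> D"
    using assms unfolding ess_bounded_def by auto
  then have "AE x in M. \<bar>f x - g x\<bar> \<le> C + D"
    by eventually_elim simp
  then show ?thesis
    using assms unfolding ess_bounded_def by auto
qed

text \<open>Write \<open>2 f = (f - g) - (- f - g)\<close> and apply the triangle inequality. This
  is the abstract lower bound: one answer \<open>g\<close> cannot be close to both \<open>f\<close>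
  and \<open>- f\<close>.\<close>

lemma (in normed_function_lattice) norm_le_max_norm_diff:
  assumes "f \<in> Y" "g \<in> Y"
  shows "N f \<le> max (N (\<lambda>x. f x - g x)) (N (\<lambda>x. - f x - g x))"
proof -
  \<comment> \<open>Differences are spelled with the factor \<open>- 1\<close> because the closure
    and norm axioms speak of sums and multiples.\<close>
  have mem: "(\<lambda>x. f x + - 1 * g x) \<in> Y" "(\<lambda>x. - 1 * f x + - 1 * g x) \<in> Y"
    using assms by (intro add_closed scale_closed; simp)+
  then have mem': "(\<lambda>x. - 1 * (- 1 * f x + - 1 * g x)) \<in> Y"
    by (intro scale_closed)
  have "2 * N f = N (\<lambda>x. 2 * f x)"
    using norm_scale[OF assms(1), of 2] by simp
  also have "(\<lambda>x. 2 * f x) = (\<lambda>x. (f x + - 1 * g x) + (- 1 * (- 1 * f x + - 1 * g x)))"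
    by auto
  also have "N \<dots> \<le> N (\<lambda>x. f x + - 1 * g x) + N (\<lambda>x. - 1 * (- 1 * f x + - 1 * g x))"
    by (rule norm_triangle[OF mem(1) mem'])
  also have "N (\<lambda>x. - 1 * (- 1 * f x + - 1 * g x)) = N (\<lambda>x. - 1 * f x + - 1 * g x)"
    using norm_scale[OF mem(2), of "- 1"] by simp
  finally show ?thesis by simp
qed


section \<open>Moduli of continuity and the class they define\<close>

text \<open>Monotonicity and subadditivity of \<omega> carry the triangle inequality for distances
  over to their images; exchanging the two points gives the absolute value. Each function whose
  minimum forms \<tau> thus obeys the bound of the class.\<close>

lemma modulus_of_continuity_abs_diff_le:
  assumes "modulus_of_continuity \<omega>"
  shows "\<bar>\<omega> \<bar>s - c\<bar> - \<omega> \<bar>t - c\<bar>\<bar> \<le> \<omega> \<bar>s - t\<bar>"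
proof -
  have "\<omega> \<bar>u - c\<bar> \<le> \<omega> \<bar>v - c\<bar> + \<omega> \<bar>u - v\<bar>" for u v
  proof -
    have "\<omega> \<bar>u - c\<bar> \<le> \<omega> (\<bar>v - c\<bar> + \<bar>u - v\<bar>)"
      using assms unfolding modulus_of_continuity_def by (auto intro: mono_onD)
    also have "\<dots> \<le> \<omega> \<bar>v - c\<bar> + \<omega> \<bar>u - v\<bar>"
      using assms unfolding modulus_of_continuity_def by auto
    finally show ?thesis .
  qed
  from this[of s t] this[of t s] show ?thesis
    by (simp add: abs_minus_commute abs_le_iff)
qed

text \<open>At \<open>c\<close> the increment of \<open>x\<close> is dominated by
  \<open>\<omega> \<bar>y - c\<bar>\<close>, which tends to \<open>\<omega> 0 = 0\<close>.\<close>

lemma H_class_continuous_on: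
  assumes "modulus_of_continuity \<omega>" "x \<in> H_class \<omega> a b"
  shows "continuous_on {a..b} x"
proof -
  have "((\<lambda>y. x y) \<longlongrightarrow> x c) (at c within {a..b})" if c: "c \<in> {a..b}" for c
  proof -
    have "((\<lambda>y. \<omega> \<bar>y - c\<bar>) \<longlongrightarrow> \<omega> 0) (at c within {a..b})"
    proof (rule continuous_on_tendsto_compose[of "{0..}" \<omega>])
      show "continuous_on {0..} \<omega>"
        using assms(1) unfolding modulus_of_continuity_def by simp
      show "((\<lambda>y. \<bar>y - c\<bar>) \<longlongrightarrow> 0) (at c within {a..b})"
        by (auto intro!: tendsto_eq_intros)
    qed auto
    then have "((\<lambda>y. \<omega> \<bar>y - c\<bar>) \<longlongrightarrow> 0) (at c within {a..b})"
      using assms(1) unfolding modulus_of_continuity_def by simp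
    then have "((\<lambda>y. x y - x c) \<longlongrightarrow> 0) (at c within {a..b})"
      by (rule Lim_null_comparison[rotated])
        (use assms(2) c in \<open>auto simp: H_class_def eventually_at_filter\<close>)
    then show ?thesis by (simp add: LIM_zero_iff)
  qed
  then show ?thesis by (auto simp: continuous_on_def)
qed

lemma H_class_uminus: "x \<in> H_class \<omega> a b \<Longrightarrow> (\<lambda>t. - x t) \<in> H_class \<omega> a b"
  unfolding H_class_def by (auto simp: abs_minus_commute)

section \<open>The extremal function \<tau>\<close>

lemma tau_le: "tau \<omega> q e t \<le> e $ j + \<omega> \<bar>t - q $ j\<bar>"
  unfolding tau_def by (intro Min_le) auto

lemma tau_attained: "\<exists>j. tau \<omega> q e t = e $ j + \<omega> \<bar>t - q $ j\<bar>"
proof -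
  have "tau \<omega> q e t \<in> range (\<lambda>j. e $ j + \<omega> \<bar>t - q $ j\<bar>)"
    unfolding tau_def by (intro Min_in) auto
  then show ?thesis by auto
qed

lemma tau_nonneg:
  assumes "modulus_of_continuity \<omega>" "\<And>j. e $ j \<ge> 0"
  shows "tau \<omega> q e t \<ge> 0"
proof -
  obtain j where "tau \<omega> q e t = e $ j + \<omega> \<bar>t - q $ j\<bar>"
    using tau_attained by blast
  then show ?thesis
    using assms unfolding modulus_of_continuity_def by auto
qed

text \<open>An index attaining the minimum at \<open>t\<close> bounds \<tau> from above at
  \<open>s\<close>, so the estimate for a single term passes to the minimum.\<close>

lemma tau_in_H_class:
  assumes "modulus_of_continuity \<omega>"
  shows "tau \<omega> q e \<in> H_class \<omega> a b"
proof -
  have "tau \<omega> q e s - tau \<omega> q e t \<le> \<omega> \<bar>s - t\<bar>" for s t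
  proof -
    obtain j where "tau \<omega> q e t = e $ j + \<omega> \<bar>t - q $ j\<bar>"
      using tau_attained by blast
    then show ?thesis
      using tau_le[of \<omega> q e s j] modulus_of_continuity_abs_diff_le[OF assms, of s "q $ j" t]
      by simp
  qed
  note le = this
  have "\<bar>tau \<omega> q e s - tau \<omega> q e t\<bar> \<le> \<omega> \<bar>s - t\<bar>" for s t
    using le[of s t] le[of t s] by (simp add: abs_minus_commute abs_le_iff)
  then show ?thesis
    unfolding H_class_def by auto
qed

text \<open>At the node \<open>q $ j\<close> the \<open>j\<close>-th term of the minimum equals
  \<open>e $ j\<close>, as \<open>\<omega> 0 = 0\<close>. Hence the values of \<tau> at the nodes
  lie within the admissible error of \<open>0\<close>, and so do those of
  \<open>- \<tau>\<close>.\<close>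

lemma zero_in_tau_information:
  assumes "modulus_of_continuity \<omega>" "\<And>j. e $ j \<ge> 0"
  shows "0 \<in> (\<lambda>u. point_values q (tau \<omega> q e) + u) ` cbox (- e) e"
    and "0 \<in> (\<lambda>u. point_values q (\<lambda>t. - tau \<omega> q e t) + u) ` cbox (- e) e"
proof -
  have le: "tau \<omega> q e (q $ j) \<le> e $ j" for j
    using tau_le[of \<omega> q e "q $ j" j] assms(1) unfolding modulus_of_continuity_def by simp
  then have bound: "\<bar>tau \<omega> q e (q $ j)\<bar> \<le> e $ j" for j
    using tau_nonneg[OF assms] by simp
  show "0 \<in> (\<lambda>u. point_values q (tau \<omega> q e) + u) ` cbox (- e) e"
    \<comment> \<open>The perturbation chosen cancels the exact information.\<close>
    by (rule image_eqI[where x = "- point_values q (tau \<omega> q e)"])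
      (use bound in \<open>auto simp: mem_box_cart point_values_def abs_le_iff minus_le_iff\<close>)
  show "0 \<in> (\<lambda>u. point_values q (\<lambda>t. - tau \<omega> q e t) + u) ` cbox (- e) e"
    by (rule image_eqI[where x = "- point_values q (\<lambda>t. - tau \<omega> q e t)"])
      (use bound in \<open>auto simp: mem_box_cart point_values_def abs_le_iff minus_le_iff\<close>)
qed

section \<open>The partition into cells and the step function\<close>

lemma cell_subset_pre_cell: "cell a b \<omega> q e j \<subseteq> pre_cell a b \<omega> q e j"
  by (subst cell.simps) auto

text \<open>Some index attains the minimum at \<open>t\<close>; if its cell omits \<open>t\<close>,
  then an earlier cell already contains it. With disjointness, the cells partition the
  interval.\<close>

lemma ex_cell:
  assumes "t \<in> {a..b}"
  shows "\<exists>j. t \<in> cell a b \<omega> q e j"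
proof -
  have "\<exists>j. t \<in> pre_cell a b \<omega> q e j"
    using tau_attained[of \<omega> q e t] assms unfolding pre_cell_def by auto
  then obtain j where "t \<in> pre_cell a b \<omega> q e j" by blast
  then have "t \<in> cell a b \<omega> q e j \<or> (\<exists>s<j. t \<in> cell a b \<omega> q e s)"
    by (subst cell.simps) auto
  then show ?thesis by blast
qed

text \<open>The set is closed, being the zero set of a continuous function on a closed
  interval.\<close>

lemma pre_cell_measurable:
  assumes "modulus_of_continuity \<omega>"
  shows "pre_cell a b \<omega> q e j \<in> sets borel"
proof -
  have "continuous_on {0..} \<omega>"
    using assms unfolding modulus_of_continuity_def by simp
  then have "continuous_on {a..b} (\<lambda>t. \<omega> \<bar>t - q $ j\<bar>)"
    by (rule continuous_on_compose2) (auto intro!: continuous_intros)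
  then have "continuous_on {a..b} (\<lambda>t. e $ j + \<omega> \<bar>t - q $ j\<bar>)"
    by (rule continuous_on_add[OF continuous_on_const])
  moreover have "continuous_on {a..b} (tau \<omega> q e)"
    by (rule H_class_continuous_on[OF assms tau_in_H_class[OF assms]])
  ultimately have "continuous_on {a..b} (\<lambda>t. tau \<omega> q e t - (e $ j + \<omega> \<bar>t - q $ j\<bar>))"
    by (rule continuous_on_diff[rotated])
  then have "closed {t \<in> {a..b}. tau \<omega> q e t - (e $ j + \<omega> \<bar>t - q $ j\<bar>) = 0}"
    by (rule continuous_closed_preimage_constant) auto
  then show ?thesis
    unfolding pre_cell_def by simp
qed

lemma cell_measurable:
  assumes "modulus_of_continuity \<omega>"
  shows "cell a b \<omega> q e j \<in> sets borel"
  using assms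
proof (induction a b \<omega> q e j rule: cell.induct)
  case (1 a b \<omega> q e j)
  have "(\<Union>s\<in>{..<j}. cell a b \<omega> q e s) \<in> sets borel"
    using 1 by (intro sets.finite_UN) auto
  then show ?case
    by (subst cell.simps) (intro sets.Diff pre_cell_measurable[OF 1(2)])
qed

text \<open>On the interval the definite description can be replaced by a finite combination of
  indicators of Borel cells, of which exactly one is nonzero at each point.\<close>

lemma step_fun_measurable:
  assumes "modulus_of_continuity \<omega>"
  shows "step_fun a b \<omega> q e z \<in> borel_measurable (restrict_space borel {a..b})"
proof -
  have "step_fun a b \<omega> q e z t = (\<Sum>j\<in>UNIV. z $ j * indicator (cell a b \<omega> q e j) t)"
    if t: "t \<in> {a..b}" for t
  proof -
    obtain i where i: "t \<in> cell a b \<omega> q e i"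
      using ex_cell[OF t] by blast
    then have "(\<Sum>j\<in>UNIV. z $ j * indicator (cell a b \<omega> q e j) t) = (\<Sum>j\<in>{i}. z $ j * 1)"
      by (intro sum.mono_neutral_cong_right)
        (auto simp: indicator_def dest: cell_disjoint)
    then show ?thesis
      using step_fun_eq[OF i] by simp
  qed
  moreover have "(\<lambda>t. \<Sum>j\<in>UNIV. z $ j * indicator (cell a b \<omega> q e j) t)
      \<in> borel_measurable (restrict_space borel {a..b})"
    by (intro measurable_restrict_space1 borel_measurable_sum borel_measurable_times
        borel_measurable_const borel_measurable_indicator cell_measurable[OF assms])
  ultimately show ?thesis
    by (subst measurable_cong) (auto simp: space_restrict_space)
qed

lemma step_fun_bounded:
  assumes "t \<in> {a..b}"
  shows "\<bar>step_fun a b \<omega> q e z t\<bar> \<le> norm z"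
proof -
  obtain j where "t \<in> cell a b \<omega> q e j"
    using ex_cell[OF assms] by blast
  from step_fun_eq[OF this] show ?thesis
    by (simp add: component_le_norm_cart)
qed

text \<open>On the cell of \<open>j\<close> the error is \<open>(x t - x (q $ j)) - u $ j\<close>.
  The two parts are at most \<open>\<omega> \<bar>t - q $ j\<bar>\<close> and \<open>e $ j\<close>,
  whose sum is \<tau> there by the choice of the cell.\<close>

lemma H_class_step_fun_diff_le_tau:
  assumes "t \<in> {a..b}" "x \<in> H_class \<omega> a b" "\<And>j. q $ j \<in> {a..b}" "u \<in> cbox (- e) e"
  shows "\<bar>x t - step_fun a b \<omega> q e (point_values q x + u) t\<bar> \<le> tau \<omega> q e t"
proof -
  obtain j where j: "t \<in> cell a b \<omega> q e j"
    using ex_cell[OF assms(1)] by blast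
  then have "tau \<omega> q e t = e $ j + \<omega> \<bar>t - q $ j\<bar>"
    using cell_subset_pre_cell unfolding pre_cell_def by blast
  moreover have "\<bar>x t - x (q $ j)\<bar> \<le> \<omega> \<bar>t - q $ j\<bar>"
    using assms unfolding H_class_def by auto
  moreover have "\<bar>u $ j\<bar> \<le> e $ j"
    using assms(4) by (auto simp: mem_box_cart abs_le_iff minus_le_iff)
  ultimately show ?thesis
    using step_fun_eq[OF j] by (simp add: point_values_def)
qed

section \<open>Iterated kernels of a bounded non-negative kernel\<close>

locale volterra_kernel =
  fixes a b C :: real and k :: "real \<Rightarrow> real \<Rightarrow> real"
  assumes kernel_measurable:
      "case_prod k \<in> borel_measurable (restrict_space borel ({a..b} \<times> {a..b}))"
    and kernel_nonneg: "\<lbrakk>t \<in> {a..b}; s \<in> {a..b}\<rbrakk> \<Longrightarrow> 0 \<le> k t s"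
    and kernel_le: "\<lbrakk>t \<in> {a..b}; s \<in> {a..b}\<rbrakk> \<Longrightarrow> k t s \<le> C"
    and C_pos: "0 < C"
begin

text \<open>
  Cutting kernels off to the triangle \<open>a \<le> s \<le> t \<le> b\<close> turns the Volterra integrals into
  integrals over the whole line with a Borel integrand, so that the measurability of parameter
  integrals applies.
\<close>

definition restr :: "(real \<Rightarrow> real \<Rightarrow> real) \<Rightarrow> real \<Rightarrow> real \<Rightarrow> real" where
  "restr h t s = (if a \<le> s \<and> s \<le> t \<and> t \<le> b then h t s else 0)"

text \<open>The kernel is controlled only on the square: one indicator extends it by zero to the
  plane, a second cuts it down to the closed triangle.\<close>

lemma restr_kernel_measurable: "case_prod (restr k) \<in> borel_measurable (borel \<Otimes>\<^sub>M borel)"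
proof -
  have "{a..b} \<times> {a..b} \<in> sets borel"
    by (intro borel_closed closed_Times closed_atLeastAtMost)
  then have "(\<lambda>p. indicator ({a..b} \<times> {a..b}) p *\<^sub>R case_prod k p) \<in> borel_measurable borel"
    using kernel_measurable by (subst borel_measurable_restrict_space_iff[symmetric]) auto
  moreover have "closed {p::real \<times> real. a \<le> snd p \<and> snd p \<le> fst p \<and> fst p \<le> b}"
    by (intro closed_Collect_conj closed_Collect_le continuous_intros)
  then have "{p::real \<times> real. a \<le> snd p \<and> snd p \<le> fst p \<and> fst p \<le> b} \<in> sets borel"
    by (rule borel_closed)
  ultimately have "(\<lambda>p. indicator {p::real \<times> real. a \<le> snd p \<and> snd p \<le> fst p \<and> fst p \<le> b} p *\<^sub>R
      (indicator ({a..b} \<times> {a..b}) p *\<^sub>R case_prod k p)) \<in> borel_measurable borel"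
    by (rule borel_measurable_scaleR[OF borel_measurable_indicator, rotated])
  also have "(\<lambda>p. indicator {p::real \<times> real. a \<le> snd p \<and> snd p \<le> fst p \<and> fst p \<le> b} p *\<^sub>R
      (indicator ({a..b} \<times> {a..b}) p *\<^sub>R case_prod k p)) = case_prod (restr k)"
    by (auto simp: restr_def indicator_def fun_eq_iff)
  finally show ?thesis
    by (simp add: borel_prod)
qed

text \<open>Measurability of the preceding iterate is a hypothesis, so that both facts can be used
  inside the induction over the iterates.\<close>

lemma restr_iterated_Suc_measurable:
  assumes "case_prod (restr (iterated_kernel k n)) \<in> borel_measurable (borel \<Otimes>\<^sub>M borel)"
  shows "(\<lambda>r. restr k t r * restr (iterated_kernel k n) r s) \<in> borel_measurable borel"
    and "(\<lambda>(t, s). \<integral>r. restr k t r * restr (iterated_kernel k n) r s \<partial>lborel)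
      \<in> borel_measurable (borel \<Otimes>\<^sub>M borel)"
proof -
  note [measurable] = assms restr_kernel_measurable
  show "(\<lambda>r. restr k t r * restr (iterated_kernel k n) r s) \<in> borel_measurable borel"
    by measurable
  show "(\<lambda>(t, s). \<integral>r. restr k t r * restr (iterated_kernel k n) r s \<partial>lborel)
      \<in> borel_measurable (borel \<Otimes>\<^sub>M borel)"
    by measurable
qed

text \<open>The product of the cut-off kernels vanishes unless
  \<open>a \<le> s \<le> r \<le> t \<le> b\<close>, so the cut-offs alone encode the range
  \<open>{s..t}\<close>. As the integrand is Borel, \<open>lebesgue\<close> may be replaced by
  \<open>lborel\<close>.\<close>

lemma restr_iterated_Suc:
  assumes "case_prod (restr (iterated_kernel k n)) \<in> borel_measurable (borel \<Otimes>\<^sub>M borel)"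
  shows "restr (iterated_kernel k (Suc n)) t s =
    (\<integral>r. restr k t r * restr (iterated_kernel k n) r s \<partial>lborel)"
proof (cases "a \<le> s \<and> s \<le> t \<and> t \<le> b")
  case True
  have "restr (iterated_kernel k (Suc n)) t s =
      (\<integral>r. indicator {s..t} r *\<^sub>R (k t r * iterated_kernel k n r s) \<partial>lebesgue)"
    using True by (simp add: restr_def set_lebesgue_integral_def)
  also have "(\<lambda>r. indicator {s..t} r *\<^sub>R (k t r * iterated_kernel k n r s)) =
      (\<lambda>r. restr k t r * restr (iterated_kernel k n) r s)"
    using True by (auto simp: restr_def indicator_def fun_eq_iff)
  finally show ?thesis
    using restr_iterated_Suc_measurable(1)[OF assms] by (simp add: integral_completion)
next
  case False
  then have "(\<lambda>r. restr k t r * restr (iterated_kernel k n) r s) = (\<lambda>r. 0)"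
    by (auto simp: restr_def fun_eq_iff)
  moreover have "restr h t s = 0" for h
    using False by (auto simp: restr_def)
  ultimately show ?thesis by simp
qed

lemma restr_iterated_measurable:
  "case_prod (restr (iterated_kernel k n)) \<in> borel_measurable (borel \<Otimes>\<^sub>M borel)"
proof (induction n)
  case 0
  then show ?case using restr_kernel_measurable by simp
next
  case (Suc n)
  have "case_prod (restr (iterated_kernel k (Suc n))) =
      (\<lambda>(t, s). \<integral>r. restr k t r * restr (iterated_kernel k n) r s \<partial>lborel)"
    using restr_iterated_Suc[OF Suc] by (auto simp: fun_eq_iff)
  then show ?case
    using restr_iterated_Suc_measurable(2)[OF Suc] by simp
qed

lemma restr_kernel_bounds: "0 \<le> restr k t s" "restr k t s \<le> C"
  using kernel_nonneg[of t s] kernel_le[of t s] C_pos by (auto simp: restr_def)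

text \<open>
  Weighting by \<open>exp (2 * C * (t - s))\<close> makes one more iteration gain a factor \<open>1 / 2\<close>,
  so a geometric series replaces the usual factorial bound.
\<close>

lemma restr_iterated_bounds:
  "0 \<le> restr (iterated_kernel k n) t s \<and>
    restr (iterated_kernel k n) t s \<le> C * (1 / 2) ^ n * exp (2 * C * (t - s))"
proof (induction n arbitrary: t s)
  case 0
  show ?case
  proof (cases "s \<le> t")
    case True
    then have "C * 1 \<le> C * exp (2 * C * (t - s))"
      using C_pos by (intro mult_left_mono) auto
    then show ?thesis
      using restr_kernel_bounds[of t s] by simp
  next
    case False
    then show ?thesis using C_pos by (simp add: restr_def)
  qed
next
  case (Suc n)
  show ?case
  proof (cases "a \<le> s \<and> s \<le> t \<and> t \<le> b")
    case True
    \<comment> \<open>\<open>?F\<close> is an antiderivative of \<open>?f\<close>: differentiation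
      produces the factor \<open>2 * C\<close>, which turns \<open>(1 / 2) ^ Suc n\<close> into
      \<open>C * (1 / 2) ^ n\<close>.\<close>
    let ?F = "\<lambda>r. C * ((1 / 2) ^ Suc n * exp (2 * C * (r - s)))"
    let ?f = "\<lambda>r. C * (C * (1 / 2) ^ n * exp (2 * C * (r - s)))"
    have deriv: "(?F has_real_derivative ?f r) (at r)" for r
      by (auto intro!: derivative_eq_intros)
    have hb: "has_bochner_integral lborel (\<lambda>r. ?f r * indicator {s..t} r) (?F t - ?F s)"
      using True deriv by (intro has_bochner_integral_FTC_Icc_real) (auto intro!: continuous_intros)
    \<comment> \<open>On \<open>{s..t}\<close> the bound \<open>C\<close> is multiplied by the
      induction hypothesis; elsewhere one of the cut-offs vanishes.\<close>
    have le: "restr k t r * restr (iterated_kernel k n) r s \<le> ?f r * indicator {s..t} r" for r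
    proof (cases "r \<in> {s..t}")
      case True
      then show ?thesis
        using Suc[of r s] restr_kernel_bounds[of t r] C_pos by (auto intro!: mult_mono)
    qed (auto simp: restr_def)
    have "(\<integral>r. restr k t r * restr (iterated_kernel k n) r s \<partial>lborel)
        \<le> (\<integral>r. ?f r * indicator {s..t} r \<partial>lborel)"
      using le hb Suc restr_kernel_bounds C_pos
      by (intro integral_mono') (auto simp: has_bochner_integral_iff)
    also have "\<dots> = ?F t - ?F s"
      using hb by (simp add: has_bochner_integral_iff)
    also have "\<dots> \<le> ?F t"
      using C_pos by simp
    finally have "restr (iterated_kernel k (Suc n)) t s \<le> ?F t"
      unfolding restr_iterated_Suc[OF restr_iterated_measurable] .
    moreover have "0 \<le> restr (iterated_kernel k (Suc n)) t s"
      unfolding restr_iterated_Suc[OF restr_iterated_measurable]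
      using Suc restr_kernel_bounds by (intro integral_nonneg_AE) auto
    ultimately show ?thesis
      by (simp only: mult.assoc simp_thms)
  next
    case False
    then show ?thesis using C_pos by (auto simp: restr_def)
  qed
qed

section \<open>Measurability, sign and size of the resolvent kernel\<close>

lemma restr_resolvent_eq: "restr (resolvent_kernel k) t s = (\<Sum>n. restr (iterated_kernel k n) t s)"
  by (cases "a \<le> s \<and> s \<le> t \<and> t \<le> b") (auto simp: restr_def resolvent_kernel_def)

lemma restr_resolvent_measurable:
  "case_prod (restr (resolvent_kernel k)) \<in> borel_measurable (borel \<Otimes>\<^sub>M borel)"
proof -
  note [measurable] = restr_iterated_measurable
  have "(\<lambda>p. \<Sum>n. case_prod (restr (iterated_kernel k n)) p) \<in> borel_measurable (borel \<Otimes>\<^sub>M borel)"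
    by measurable
  also have "(\<lambda>p. \<Sum>n. case_prod (restr (iterated_kernel k n)) p) = case_prod (restr (resolvent_kernel k))"
    by (auto simp: restr_resolvent_eq fun_eq_iff)
  finally show ?thesis .
qed

text \<open>On the triangle \<open>t - s \<le> b - a\<close>, so the weight is at most a constant
  and the series is dominated by a geometric one of ratio \<open>1 / 2\<close>; its sum
  \<open>2\<close> is the leading factor of the bound.\<close>

lemma restr_resolvent_bounds:
  "0 \<le> restr (resolvent_kernel k) t s"
  "restr (resolvent_kernel k) t s \<le> 2 * C * exp (2 * C * (b - a))"
proof -
  let ?E = "exp (2 * C * (b - a))"
  have le: "restr (iterated_kernel k n) t s \<le> C * ?E * (1 / 2) ^ n" for n
  proof (cases "a \<le> s \<and> s \<le> t \<and> t \<le> b")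
    case True
    then have "C * (1 / 2) ^ n * exp (2 * C * (t - s)) \<le> C * (1 / 2) ^ n * ?E"
      using C_pos by (intro mult_left_mono) auto
    then show ?thesis
      using restr_iterated_bounds[of n t s] by (simp add: ac_simps)
  next
    case False
    then show ?thesis using C_pos by (auto simp: restr_def)
  qed
  have geo: "(\<lambda>n. C * ?E * (1 / 2) ^ n) sums (C * ?E * 2)"
    using geometric_sums[of "1 / 2 :: real"] by (intro sums_mult) simp
  \<comment> \<open>Summability comes first, since the value of a divergent \<open>suminf\<close> is
    unspecified.\<close>
  have summ: "summable (\<lambda>n. restr (iterated_kernel k n) t s)"
    using le restr_iterated_bounds
    by (intro summable_comparison_test'[OF sums_summable[OF geo], of 0]) auto
  show "0 \<le> restr (resolvent_kernel k) t s"
    unfolding restr_resolvent_eq using restr_iterated_bounds by (intro suminf_nonneg summ) auto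
  show "restr (resolvent_kernel k) t s \<le> 2 * C * ?E"
    unfolding restr_resolvent_eq
    using suminf_le[OF le summ sums_summable[OF geo]] sums_unique[OF geo] by simp
qed

section \<open>The solution operator on bounded measurable functions\<close>

text \<open>With \<open>f\<close> extended by zero and the resolvent cut off, the Lebesgue integral
  over \<open>{a..t}\<close> becomes a Borel integral over the line, whose integrand is jointly
  measurable in \<open>t\<close> and \<open>s\<close>.\<close>

lemma volterra_solution_eq:
  assumes "f \<in> borel_measurable (restrict_space borel {a..b})" "t \<in> {a..b}"
  shows "volterra_solution a k f t =
    f t + (\<integral>s. restr (resolvent_kernel k) t s * (indicator {a..b} s *\<^sub>R f s) \<partial>lborel)"
proof -
  have [measurable]: "(\<lambda>s. indicator {a..b} s *\<^sub>R f s) \<in> borel_measurable borel"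
    using assms(1) by (subst borel_measurable_restrict_space_iff[symmetric]) auto
  note [measurable] = restr_resolvent_measurable
  have "(LINT s:{a..t}|lebesgue. resolvent_kernel k t s * f s) =
      (\<integral>s. restr (resolvent_kernel k) t s * (indicator {a..b} s *\<^sub>R f s) \<partial>lebesgue)"
    unfolding set_lebesgue_integral_def using assms(2)
    by (intro Bochner_Integration.integral_cong) (auto simp: restr_def indicator_def)
  also have "\<dots> = (\<integral>s. restr (resolvent_kernel k) t s * (indicator {a..b} s *\<^sub>R f s) \<partial>lborel)"
    by (intro integral_completion) measurable
  finally show ?thesis
    by (simp add: volterra_solution_def)
qed

text \<open>A constant multiple of the indicator of the interval dominates the integrand. Its
  integral is left unevaluated: what matters is that it does not depend on \<open>t\<close>.\<close>

lemma
  assumes "f \<in> borel_measurable (restrict_space borel {a..b})" "\<And>s. s \<in> {a..b} \<Longrightarrow> \<bar>f s\<bar> \<le> D"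
  shows volterra_integrand_integrable:
      "integrable lborel (\<lambda>s. restr (resolvent_kernel k) t s * (indicator {a..b} s *\<^sub>R f s))"
    and abs_volterra_integral_le:
      "\<bar>\<integral>s. restr (resolvent_kernel k) t s * (indicator {a..b} s *\<^sub>R f s) \<partial>lborel\<bar>
      \<le> (\<integral>s. 2 * C * exp (2 * C * (b - a)) * D * indicator {a..b} s \<partial>lborel)"
proof -
  let ?R = "2 * C * exp (2 * C * (b - a))"
  have [measurable]: "(\<lambda>s. indicator {a..b} s *\<^sub>R f s) \<in> borel_measurable borel"
    using assms(1) by (subst borel_measurable_restrict_space_iff[symmetric]) auto
  note [measurable] = restr_resolvent_measurable
  have bound: "\<bar>restr (resolvent_kernel k) t s * (indicator {a..b} s *\<^sub>R f s)\<bar>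
      \<le> ?R * D * indicator {a..b} s" for s
  proof (cases "s \<in> {a..b}")
    case True
    then have "restr (resolvent_kernel k) t s * \<bar>f s\<bar> \<le> ?R * D"
      using restr_resolvent_bounds[of t s] assms(2)[of s] C_pos by (intro mult_mono) auto
    with True show ?thesis
      using restr_resolvent_bounds[of t s] by (simp add: abs_mult)
  qed auto
  have int: "integrable lborel (\<lambda>s. ?R * D * indicator {a..b} s)"
    by (intro integrable_mult_right integrable_real_indicator) (auto simp: emeasure_lborel_Icc_eq)
  show intg: "integrable lborel (\<lambda>s. restr (resolvent_kernel k) t s * (indicator {a..b} s *\<^sub>R f s))"
  proof (rule Bochner_Integration.integrable_bound[OF int])
    show "AE s in lborel. norm (restr (resolvent_kernel k) t s * (indicator {a..b} s *\<^sub>R f s))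
        \<le> norm (?R * D * indicator {a..b} s)"
      using order_trans[OF bound abs_ge_self] by (simp only: real_norm_def AE_I2)
  qed measurable
  have "\<bar>\<integral>s. restr (resolvent_kernel k) t s * (indicator {a..b} s *\<^sub>R f s) \<partial>lborel\<bar>
      \<le> (\<integral>s. \<bar>restr (resolvent_kernel k) t s * (indicator {a..b} s *\<^sub>R f s)\<bar> \<partial>lborel)"
    by (rule integral_abs_bound)
  also have "\<dots> \<le> (\<integral>s. ?R * D * indicator {a..b} s \<partial>lborel)"
    by (intro integral_mono bound int integrable_abs intg)
  finally show "\<bar>\<integral>s. restr (resolvent_kernel k) t s * (indicator {a..b} s *\<^sub>R f s) \<partial>lborel\<bar>
      \<le> (\<integral>s. ?R * D * indicator {a..b} s \<partial>lborel)" .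
qed

text \<open>On the interval the solution agrees with a Borel function of \<open>t\<close>, and the
  bound on the integral is uniform in \<open>t\<close>.\<close>

lemma volterra_solution_ess_bounded:
  assumes "f \<in> borel_measurable (restrict_space borel {a..b})" "\<And>s. s \<in> {a..b} \<Longrightarrow> \<bar>f s\<bar> \<le> D"
  shows "volterra_solution a k f \<in> ess_bounded (lebesgue_on {a..b})"
proof -
  have [measurable]: "(\<lambda>s. indicator {a..b} s *\<^sub>R f s) \<in> borel_measurable borel"
    using assms(1) by (subst borel_measurable_restrict_space_iff[symmetric]) auto
  note [measurable] = restr_resolvent_measurable
  let ?I = "\<lambda>t. \<integral>s. restr (resolvent_kernel k) t s * (indicator {a..b} s *\<^sub>R f s) \<partial>lborel"
  have "(\<lambda>t. indicator {a..b} t *\<^sub>R f t + ?I t) \<in> borel_measurable borel"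
    by measurable
  then have "(\<lambda>t. indicator {a..b} t *\<^sub>R f t + ?I t) \<in> borel_measurable (lebesgue_on {a..b})"
    by (intro measurable_restrict_space1 measurable_completion) simp
  moreover have "volterra_solution a k f t = indicator {a..b} t *\<^sub>R f t + ?I t"
    if "t \<in> space (lebesgue_on {a..b})" for t
    using volterra_solution_eq[OF assms(1), of t] that by (simp add: space_restrict_space)
  ultimately have "volterra_solution a k f \<in> borel_measurable (lebesgue_on {a..b})"
    by (subst measurable_cong)
  moreover have "\<bar>volterra_solution a k f t\<bar>
      \<le> D + (\<integral>s. 2 * C * exp (2 * C * (b - a)) * D * indicator {a..b} s \<partial>lborel)"
    if "t \<in> space (lebesgue_on {a..b})" for t
  proof -
    have t: "t \<in> {a..b}" using that by (simp add: space_restrict_space)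
    show ?thesis
      using volterra_solution_eq[OF assms(1) t] assms(2)[OF t]
        abs_volterra_integral_le[OF assms, of t] by linarith
  qed
  then have "AE t in lebesgue_on {a..b}. \<bar>volterra_solution a k f t\<bar>
      \<le> D + (\<integral>s. 2 * C * exp (2 * C * (b - a)) * D * indicator {a..b} s \<partial>lborel)"
    by (rule AE_I2)
  ultimately show ?thesis
    unfolding ess_bounded_def by blast
qed

text \<open>A non-negative resolvent makes the operator positive: the absolute value moves inside
  the integral and \<open>\<bar>f - g\<bar>\<close> is replaced by \<open>h\<close> under it. The
  constant bounds provide integrability.\<close>

lemma volterra_solution_diff_le:
  assumes f: "f \<in> borel_measurable (restrict_space borel {a..b})" "\<And>s. s \<in> {a..b} \<Longrightarrow> \<bar>f s\<bar> \<le> D"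
    and g: "g \<in> borel_measurable (restrict_space borel {a..b})" "\<And>s. s \<in> {a..b} \<Longrightarrow> \<bar>g s\<bar> \<le> E"
    and h: "h \<in> borel_measurable (restrict_space borel {a..b})" "\<And>s. s \<in> {a..b} \<Longrightarrow> \<bar>h s\<bar> \<le> F"
    and le: "\<And>s. s \<in> {a..b} \<Longrightarrow> \<bar>f s - g s\<bar> \<le> h s" and t: "t \<in> {a..b}"
  shows "\<bar>volterra_solution a k f t - volterra_solution a k g t\<bar> \<le> volterra_solution a k h t"
proof -
  let ?G = "restr (resolvent_kernel k) t" and ?i = "indicator {a..b} :: real \<Rightarrow> real"
  note int = volterra_integrand_integrable
  have "\<bar>(\<integral>s. ?G s * (?i s *\<^sub>R f s) \<partial>lborel) - (\<integral>s. ?G s * (?i s *\<^sub>R g s) \<partial>lborel)\<bar> =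
      \<bar>\<integral>s. ?G s * (?i s *\<^sub>R f s) - ?G s * (?i s *\<^sub>R g s) \<partial>lborel\<bar>"
    by (subst Bochner_Integration.integral_diff[OF int[OF f] int[OF g]]) auto
  also have "\<dots> \<le> (\<integral>s. \<bar>?G s * (?i s *\<^sub>R f s) - ?G s * (?i s *\<^sub>R g s)\<bar> \<partial>lborel)"
    by (rule integral_abs_bound)
  also have "\<dots> \<le> (\<integral>s. ?G s * (?i s *\<^sub>R h s) \<partial>lborel)"
  proof (intro integral_mono integrable_abs Bochner_Integration.integrable_diff int[OF f] int[OF g] int[OF h])
    fix s
    have "?G s * \<bar>f s - g s\<bar> \<le> ?G s * h s" if "s \<in> {a..b}"
      using restr_resolvent_bounds(1) le[OF that] by (rule mult_left_mono[rotated])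
    then show "\<bar>?G s * (?i s *\<^sub>R f s) - ?G s * (?i s *\<^sub>R g s)\<bar> \<le> ?G s * (?i s *\<^sub>R h s)"
      using restr_resolvent_bounds(1)[of t s]
      by (cases "s \<in> {a..b}") (auto simp: abs_mult right_diff_distrib[symmetric])
  qed
  finally show ?thesis
    using le[OF t] volterra_solution_eq[OF f(1) t] volterra_solution_eq[OF g(1) t]
      volterra_solution_eq[OF h(1) t] by linarith
qed

end

section \<open>Continuous kernels, negation, and boundedness of the class\<close>

text \<open>Compactness of the square yields the uniform bound, and continuity the Borel
  measurability.\<close>

lemma continuous_volterra_kernel:
  assumes "continuous_on ({a..b} \<times> {a..b}) (\<lambda>(t, s). k t s)"
    and "\<And>t s. t \<in> {a..b} \<Longrightarrow> s \<in> {a..b} \<Longrightarrow> k t s \<ge> 0"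
  obtains C where "volterra_kernel a b C k"
proof -
  have "bounded ((\<lambda>(t, s). k t s) ` ({a..b} \<times> {a..b}))"
    using assms(1) by (intro compact_imp_bounded compact_continuous_image compact_Times) auto
  then obtain C where C: "0 < C" "\<And>t s. t \<in> {a..b} \<Longrightarrow> s \<in> {a..b} \<Longrightarrow> \<bar>k t s\<bar> \<le> C"
    unfolding bounded_pos by fastforce
  have "volterra_kernel a b C k"
    by unfold_locales (use C assms borel_measurable_continuous_on_restrict[OF assms(1)] in \<open>force simp: abs_le_iff\<close>)+
  then show thesis by (rule that)
qed

lemma volterra_solution_uminus:
  "volterra_solution a k (\<lambda>t. - f t) = (\<lambda>t. - volterra_solution a k f t)"
  by (simp add: volterra_solution_def set_lebesgue_integral_def fun_eq_iff)

lemma H_class_bounded: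
  assumes "modulus_of_continuity \<omega>" "x \<in> H_class \<omega> a b"
  obtains D where "\<And>t. t \<in> {a..b} \<Longrightarrow> \<bar>x t\<bar> \<le> D"
proof -
  have "bounded (x ` {a..b})"
    by (intro compact_imp_bounded compact_continuous_image H_class_continuous_on[OF assms]) auto
  then show thesis
    using that unfolding bounded_iff by (metis imageI real_norm_def)
qed

section \<open>Optimality of the method and the value of the error\<close>

theorem corollary3:
  fixes a b :: real
    and \<omega> :: "real \<Rightarrow> real"
    and q e :: "real ^ 'n::{finite,linorder}"
    and k :: "real \<Rightarrow> real \<Rightarrow> real"
    and Y :: "(real \<Rightarrow> real) set"
    and N :: "(real \<Rightarrow> real) \<Rightarrow> real"
  assumes "a \<le> b"
    and "modulus_of_continuity \<omega>"
    and "\<And>j. q $ j \<in> {a..b}" and "inj (($) q)"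
    and "\<And>j. e $ j \<ge> 0"
    and "continuous_on ({a..b} \<times> {a..b}) (\<lambda>(t, s). k t s)"
    and "normed_function_lattice (lebesgue_on {a..b}) Y N"
    and "ess_bounded (lebesgue_on {a..b}) \<subseteq> Y"
    and "\<And>t s. t \<in> {a..b} \<Longrightarrow> s \<in> {a..b} \<Longrightarrow> k t s \<ge> 0"
  shows "let A = volterra_solution a k;
             W = H_class \<omega> a b;
             I = point_values q;
             U = cbox (- e) e;
             \<tau> = tau \<omega> q e;
             \<Phi> = (\<lambda>z. A (step_fun a b \<omega> q e z))
         in optimal_method Y N A W I U \<Phi> \<and>
            optimal_recovery_error Y N A W I U = recovery_error N A W I U \<Phi> \<and>
            recovery_error N A W I U \<Phi> = ereal (N (A \<tau>)) \<and>
            N (A \<tau>) = N (\<lambda>t. \<tau> t + (LINT s:{a..t}|lebesgue. resolvent_kernel k t s * \<tau> s))"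
proof -
  define A W I U \<tau> \<Phi> where "A = volterra_solution a k" and "W = H_class \<omega> a b"
    and "I = point_values q" and "U = cbox (- e) e" and "\<tau> = tau \<omega> q e"
    and "\<Phi> = (\<lambda>z. A (step_fun a b \<omega> q e z))"
  note defs = A_def W_def I_def U_def \<tau>_def \<Phi>_def
  interpret normed_function_lattice "lebesgue_on {a..b}" Y N by fact
  obtain C where "volterra_kernel a b C k"
    using continuous_volterra_kernel[OF assms(6,9)] .
  then interpret volterra_kernel a b C k .
  have W_measurable: "x \<in> borel_measurable (restrict_space borel {a..b})" if "x \<in> W" for x
    using that H_class_continuous_on[OF assms(2)] unfolding W_def
    by (intro borel_measurable_continuous_on_restrict) auto
  have A_W: "A x \<in> ess_bounded (lebesgue_on {a..b})" if "x \<in> W" for x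
    using that H_class_bounded[OF assms(2), of x a b] W_measurable[OF that]
      volterra_solution_ess_bounded[of x] unfolding A_def W_def by metis
  have \<Phi>_ess: "\<Phi> z \<in> ess_bounded (lebesgue_on {a..b})" for z
    unfolding \<Phi>_def A_def
    by (rule volterra_solution_ess_bounded[OF step_fun_measurable[OF assms(2)] step_fun_bounded])
  have \<tau>_W: "\<tau> \<in> W" "(\<lambda>t. - \<tau> t) \<in> W"
    unfolding \<tau>_def W_def by (intro H_class_uminus tau_in_H_class assms(2))+
  have upper: "N (\<lambda>t. A x t - \<Phi> (I x + u) t) \<le> N (A \<tau>)" if x: "x \<in> W" and u: "u \<in> U" for x u
  proof -
    obtain D where D: "\<And>t. t \<in> {a..b} \<Longrightarrow> \<bar>x t\<bar> \<le> D"
      using H_class_bounded[OF assms(2)] x unfolding W_def by metis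
    obtain E where E: "\<And>t. t \<in> {a..b} \<Longrightarrow> \<bar>\<tau> t\<bar> \<le> E"
      using H_class_bounded[OF assms(2)] \<tau>_W(1) unfolding W_def by metis
    \<comment> \<open>The right side carries an absolute value to fit
      \<open>norm_le_of_abs_le\<close>; positivity of the operator gives the bound without
      it.\<close>
    have "\<bar>A x t - \<Phi> (I x + u) t\<bar> \<le> \<bar>A \<tau> t\<bar>" if t: "t \<in> {a..b}" for t
    proof -
      have "\<bar>A x t - \<Phi> (I x + u) t\<bar> \<le> A \<tau> t"
        unfolding A_def \<Phi>_def
      proof (rule volterra_solution_diff_le[OF W_measurable[OF x] D
            step_fun_measurable[OF assms(2)] step_fun_bounded W_measurable[OF \<tau>_W(1)] E _ t])
        show "\<bar>x s - step_fun a b \<omega> q e (I x + u) s\<bar> \<le> \<tau> s" if "s \<in> {a..b}" for s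
          using H_class_step_fun_diff_le_tau[OF that _ assms(3)] x u unfolding defs by blast
      qed
      then show ?thesis by linarith
    qed
    then have "AE t in lebesgue_on {a..b}. \<bar>A x t - \<Phi> (I x + u) t\<bar> \<le> \<bar>A \<tau> t\<bar>"
      by (intro AE_I2) (simp add: space_restrict_space)
    then show ?thesis
      using A_W[OF x] A_W[OF \<tau>_W(1)] \<Phi>_ess assms(8)
      by (intro norm_le_of_abs_le subsetD[OF assms(8)] abs_ess_bounded ess_bounded_diff)
  qed
  have lower: "ereal (N (A \<tau>)) \<le> recovery_error N A W I U \<Psi>" if "\<Psi> \<in> recovery_methods Y" for \<Psi>
  proof -
    \<comment> \<open>The datum \<open>0\<close> contributes one term to the supremum for each
      \<open>x\<close> compatible with it.\<close>
    have le: "ereal (N (\<lambda>t. A x t - \<Psi> 0 t)) \<le> recovery_error N A W I U \<Psi>"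
      if "x \<in> W" "0 \<in> (\<lambda>u. I x + u) ` U" for x
      unfolding recovery_error_def using that by (intro SUP_upper2[of x] SUP_upper) auto
    note info = zero_in_tau_information[OF assms(2,5), of q, folded defs]
    \<comment> \<open>The single answer \<open>\<Psi> 0\<close> must serve both \<tau> and
      \<open>- \<tau>\<close>, whose images are \<open>A \<tau>\<close> and
      \<open>- A \<tau>\<close>.\<close>
    have "N (A \<tau>) \<le> max (N (\<lambda>t. A \<tau> t - \<Psi> 0 t)) (N (\<lambda>t. - A \<tau> t - \<Psi> 0 t))"
      using A_W[OF \<tau>_W(1)] assms(8) that
      by (intro norm_le_max_norm_diff) (auto simp: recovery_methods_def)
    then have "ereal (N (A \<tau>)) \<le>
        max (ereal (N (\<lambda>t. A \<tau> t - \<Psi> 0 t))) (ereal (N (\<lambda>t. - A \<tau> t - \<Psi> 0 t)))"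
      by (simp add: le_max_iff_disj)
    also have "\<dots> \<le> recovery_error N A W I U \<Psi>"
    proof (rule max.boundedI)
      show "ereal (N (\<lambda>t. - A \<tau> t - \<Psi> 0 t)) \<le> recovery_error N A W I U \<Psi>"
        using le[OF \<tau>_W(2) info(2)] unfolding A_def volterra_solution_uminus .
    qed (rule le[OF \<tau>_W(1) info(1)])
    finally show ?thesis .
  qed
  have \<Phi>_method: "\<Phi> \<in> recovery_methods Y"
    using \<Phi>_ess assms(8) unfolding recovery_methods_def by auto
  have error: "recovery_error N A W I U \<Phi> = ereal (N (A \<tau>))"
  proof (rule antisym[OF _ lower[OF \<Phi>_method]])
    show "recovery_error N A W I U \<Phi> \<le> ereal (N (A \<tau>))"
      unfolding recovery_error_def by (intro SUP_least) (auto intro: upper)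
  qed
  \<comment> \<open>\<open>\<Phi>\<close> itself competes in the infimum, and \<open>lower\<close>
    shows that no method does better.\<close>
  moreover have "optimal_recovery_error Y N A W I U = recovery_error N A W I U \<Phi>"
    unfolding optimal_recovery_error_def
    by (rule antisym[OF INF_lower[OF \<Phi>_method]]) (auto intro: INF_greatest lower simp: error)
  moreover have "N (A \<tau>) = N (\<lambda>t. \<tau> t + (LINT s:{a..t}|lebesgue. resolvent_kernel k t s * \<tau> s))"
    unfolding A_def volterra_solution_def ..
  ultimately show ?thesis
    unfolding Let_def optimal_method_def defs[symmetric] using \<Phi>_method by simp
qed

end
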